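(* Let $\mathcal{H}$ be a separable infinite-dimensional Hilbert space with orthonormal basis $\{e_j\}_{j\in\mathbb{N}}$, and put $L_m:=\mathrm{span}\{e_1,\ldots,e_m\}$ for $m\in\mathbb{N}$. Let $U,W\in B(\mathcal{H})$ be such that $W$ is invertible and $U$ is unitary. Suppose that for each $m\in\mathbb{N}$ there are sequences $(E_k)$ and $(R_k)$ of subspaces of $L_m$ and a strictly increasing sequence $(n_k)$ of positive integers such that $L_m=E_k\oplus R_k$ (orthogonal direct sum) for each $k$, and $$\lim_{k\to\infty}\|W^{n_k}P_m\|=\lim_{k\to\infty}\|W^{-n_k}P_m\|=0,$$ $$\lim_{k\to\infty}\|W^{2n_k}P_{E_k}\|=\lim_{k\to\infty}\|W^{-2n_k}P_{R_k}\|=0.$$ Then the sequence $(C^{(n)}_{U,W})_{n\in\mathbb{N}_0}$ is topologically transitive on $B_0(\mathcal{H})$.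
   Context: $B(\mathcal{H})$ is the space of bounded linear operators on $\mathcal{H}$ and $B_0(\mathcal{H})$ the space of compact operators with the operator norm. For a closed subspace $\mathcal{M}$ of $\mathcal{H}$, $P_{\mathcal{M}}$ is the orthogonal projection onto $\mathcal{M}$, and $P_m:=P_{L_m}$. $T_{U,W}(F):=WFU$, $S_{U,W}(F):=W^{-1}FU^{-1}$, and $C^{(n)}_{U,W}:=\frac12\left(T^n_{U,W}+S^n_{U,W}\right)$ for $n\in\mathbb{N}_0$. A sequence $(T_n)_{n\in\mathbb{N}_0}$ of bounded operators on a Banach space $\mathcal{X}$ is topologically transitive if for all non-empty open $A,B\subseteq\mathcal{X}$ there is $n\in\mathbb{N}$ with $T_n(A)\cap B\neq\varnothing$. *)

theory Defs
  imports "HOL-Analysis.Analysis"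
begin

section \<open>Complex Hilbert spaces\<close>

text \<open>
  The library has real inner product spaces only. A complex inner product space is a real one
  equipped with a complex scalar multiplication and a sesquilinear form, linear in the first
  argument, whose real part is the real inner product. Hence \<open>norm x ^ 2 = Re (cinner x x)\<close>, and
  the norm, metric and topology of the library are those of the complex inner product.
\<close>

class complex_inner = real_inner +
  fixes scaleC :: "complex \<Rightarrow> 'a \<Rightarrow> 'a" (infixr \<open>*\<^sub>C\<close> 75)
    and cinner :: "'a \<Rightarrow> 'a \<Rightarrow> complex"
  assumes scaleC_add_right: "c *\<^sub>C (x + y) = c *\<^sub>C x + c *\<^sub>C y"
    and scaleC_add_left: "(c + d) *\<^sub>C x = c *\<^sub>C x + d *\<^sub>C x"
    and scaleC_scaleC: "c *\<^sub>C (d *\<^sub>C x) = (c * d) *\<^sub>C x"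
    and scaleC_of_real: "complex_of_real r *\<^sub>C x = r *\<^sub>R x"
    and cinner_commute: "cinner x y = cnj (cinner y x)"
    and cinner_add_left: "cinner (x + y) z = cinner x z + cinner y z"
    and cinner_scaleC_left: "cinner (c *\<^sub>C x) y = c * cinner x y"
    and Re_cinner: "Re (cinner x y) = inner x y"

class complex_hilbert = complex_inner + complete_space

instantiation complex :: complex_hilbert
begin

definition scaleC_complex :: "complex \<Rightarrow> complex \<Rightarrow> complex"
  where "scaleC_complex c x = c * x"

definition cinner_complex :: "complex \<Rightarrow> complex \<Rightarrow> complex"
  where "cinner_complex x y = x * cnj y"

instance
  by standard
    (auto simp: scaleC_complex_def cinner_complex_def algebra_simps inner_complex_def
      scaleR_conv_of_real)

end

global_interpretation complex_vector: vector_space "scaleC :: complex \<Rightarrow> 'a \<Rightarrow> 'a::complex_inner"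
  defines csubspace = complex_vector.subspace
    and cspan = complex_vector.span
proof
  show "1 *\<^sub>C x = x" for x :: 'a
    using scaleC_of_real[of 1 x] by simp
qed (simp_all add: scaleC_add_right scaleC_add_left scaleC_scaleC)

definition orthonormal_basis_on :: "'i set \<Rightarrow> ('i \<Rightarrow> 'a::complex_hilbert) \<Rightarrow> bool"
  where "orthonormal_basis_on I e \<longleftrightarrow>
    (\<forall>i\<in>I. \<forall>j\<in>I. cinner (e i) (e j) = (if i = j then 1 else 0)) \<and>
    closure (cspan (e ` I)) = UNIV"

definition orthogonal_direct_sum ::
    "'a::complex_hilbert set \<Rightarrow> 'a set \<Rightarrow> 'a set \<Rightarrow> bool"
  where "orthogonal_direct_sum L E R \<longleftrightarrow>
    csubspace E \<and> csubspace R \<and>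
    (\<forall>x\<in>E. \<forall>y\<in>R. cinner x y = 0) \<and>
    L = {x + y | x y. x \<in> E \<and> y \<in> R}"

section \<open>Bounded and compact operators\<close>

text \<open>
  The elements of the library type \<^typ>\<open>'a \<Rightarrow>\<^sub>L 'a\<close> are the bounded real-linear
  operators, with the operator norm. The spaces of bounded and of compact operators are therefore
  carrier sets in that type, cut out by complex homogeneity.
\<close>

definition bounded_ops :: "('a::complex_hilbert \<Rightarrow>\<^sub>L 'a) set"
  where "bounded_ops = {F. \<forall>c x. blinfun_apply F (c *\<^sub>C x) = c *\<^sub>C blinfun_apply F x}"

definition compact_ops :: "('a::complex_hilbert \<Rightarrow>\<^sub>L 'a) set"
  where "compact_ops =
    {F \<in> bounded_ops. \<forall>B. bounded B \<longrightarrow> compact (closure (blinfun_apply F ` B))}"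

primrec op_pow :: "('a::complex_hilbert \<Rightarrow>\<^sub>L 'a) \<Rightarrow> nat \<Rightarrow> ('a \<Rightarrow>\<^sub>L 'a)"
  where
    "op_pow F 0 = id_blinfun"
  | "op_pow F (Suc n) = F o\<^sub>L op_pow F n"

definition is_inverse_op ::
    "('a::complex_hilbert \<Rightarrow>\<^sub>L 'a) \<Rightarrow> ('a \<Rightarrow>\<^sub>L 'a) \<Rightarrow> bool"
  where "is_inverse_op W V \<longleftrightarrow>
    V \<in> bounded_ops \<and> W o\<^sub>L V = id_blinfun \<and> V o\<^sub>L W = id_blinfun"

definition invertible_op :: "('a::complex_hilbert \<Rightarrow>\<^sub>L 'a) \<Rightarrow> bool"
  where "invertible_op W \<longleftrightarrow> (\<exists>V. is_inverse_op W V)"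

text \<open>Meaningful for invertible operators only, where the inverse is unique.\<close>

definition inverse_op :: "('a::complex_hilbert \<Rightarrow>\<^sub>L 'a) \<Rightarrow> ('a \<Rightarrow>\<^sub>L 'a)"
  where "inverse_op W = (THE V. is_inverse_op W V)"

definition is_adjoint_op ::
    "('a::complex_hilbert \<Rightarrow>\<^sub>L 'a) \<Rightarrow> ('a \<Rightarrow>\<^sub>L 'a) \<Rightarrow> bool"
  where "is_adjoint_op U V \<longleftrightarrow>
    V \<in> bounded_ops \<and>
    (\<forall>x y. cinner (blinfun_apply U x) y = cinner x (blinfun_apply V y))"

definition unitary_op :: "('a::complex_hilbert \<Rightarrow>\<^sub>L 'a) \<Rightarrow> bool"
  where "unitary_op U \<longleftrightarrow> U \<in> bounded_ops \<and>
    (\<exists>V. is_adjoint_op U V \<and> U o\<^sub>L V = id_blinfun \<and> V o\<^sub>L U = id_blinfun)"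

text \<open>
  The orthogonal projection onto a closed subspace \<open>M\<close> is the operator sending \<open>x\<close> to the
  unique point \<open>p\<close> of \<open>M\<close> with \<open>x - p\<close> orthogonal to \<open>M\<close>.
\<close>

definition is_orth_proj :: "'a::complex_hilbert set \<Rightarrow> ('a \<Rightarrow>\<^sub>L 'a) \<Rightarrow> bool"
  where "is_orth_proj M P \<longleftrightarrow>
    (\<forall>x. blinfun_apply P x \<in> M \<and> (\<forall>z\<in>M. cinner (x - blinfun_apply P x) z = 0))"

definition orth_proj :: "'a::complex_hilbert set \<Rightarrow> ('a \<Rightarrow>\<^sub>L 'a)"
  where "orth_proj M = (THE P. is_orth_proj M P)"

section \<open>The cosine operator sequence\<close>

definition T_op :: "('a::complex_hilbert \<Rightarrow>\<^sub>L 'a) \<Rightarrow> ('a \<Rightarrow>\<^sub>L 'a) \<Rightarrow> ('a \<Rightarrow>\<^sub>L 'a) \<Rightarrow> ('a \<Rightarrow>\<^sub>L 'a)"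
  where "T_op U W F = W o\<^sub>L F o\<^sub>L U"

definition S_op :: "('a::complex_hilbert \<Rightarrow>\<^sub>L 'a) \<Rightarrow> ('a \<Rightarrow>\<^sub>L 'a) \<Rightarrow> ('a \<Rightarrow>\<^sub>L 'a) \<Rightarrow> ('a \<Rightarrow>\<^sub>L 'a)"
  where "S_op U W F = inverse_op W o\<^sub>L F o\<^sub>L inverse_op U"

definition cosine_op ::
    "('a::complex_hilbert \<Rightarrow>\<^sub>L 'a) \<Rightarrow> ('a \<Rightarrow>\<^sub>L 'a) \<Rightarrow> nat \<Rightarrow> ('a \<Rightarrow>\<^sub>L 'a) \<Rightarrow> ('a \<Rightarrow>\<^sub>L 'a)"
  where "cosine_op U W n F = (1/2) *\<^sub>R ((T_op U W ^^ n) F + (S_op U W ^^ n) F)"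

text \<open>
  The space is given by a carrier \<open>X\<close> with the subspace topology. The sequence is indexed by all
  natural numbers, but the witnessing index is positive.
\<close>

definition topologically_transitive_on ::
    "'b::real_normed_vector set \<Rightarrow> (nat \<Rightarrow> 'b \<Rightarrow> 'b) \<Rightarrow> bool"
  where "topologically_transitive_on X T \<longleftrightarrow>
    (\<forall>A B. openin (top_of_set X) A \<and> openin (top_of_set X) B \<and> A \<noteq> {} \<and> B \<noteq> {} \<longrightarrow>
      (\<exists>n\<ge>1. T n ` A \<inter> B \<noteq> {}))"

end

theory Submission
  imports Defs
begin

text \<open>
  Every compact operator is the norm limit of its compressions \<open>P\<^sub>m F\<close>, so transitivity need
  only be tested on targets \<open>F = P\<^sub>m F\<close> and \<open>G = P\<^sub>m G\<close>. Splitting \<open>G = P\<^sub>E G + P\<^sub>R G\<close>, the operator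
  \<open>F + 2 T\<^sup>n (P\<^sub>E G) + 2 S\<^sup>n (P\<^sub>R G)\<close> is close to \<open>F\<close>, and its image under the cosine operator
  \<open>(T\<^sup>n + S\<^sup>n) / 2\<close> is
  \<open>(T\<^sup>n F + S\<^sup>n F) / 2 + T\<^bsup>2n\<^esup> (P\<^sub>E G) + S\<^bsup>2n\<^esup> (P\<^sub>R G) + G\<close>, which is close to \<open>G\<close>.
\<close>

section \<open>Composition algebra of bounded operators\<close>

lemma blinfun_compose_assoc: "A o\<^sub>L B o\<^sub>L C = A o\<^sub>L (B o\<^sub>L C)"
  by (rule blinfun_eqI) simp

lemma blinfun_compose_id_right: "A o\<^sub>L id_blinfun = A"
  by (rule blinfun_eqI) simp

lemma blinfun_compose_add_left: "(A + B) o\<^sub>L C = (A o\<^sub>L C) + (B o\<^sub>L C)"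
  by (rule blinfun_eqI) (simp add: blinfun.add_left)

section \<open>Sesquilinearity\<close>

lemma cinner_add_right: "cinner x (y + z) = cinner x y + cinner x z"
  for x :: "'a::complex_inner"
  by (metis cinner_add_left cinner_commute complex_cnj_add)

lemma cinner_scaleC_right: "cinner x (c *\<^sub>C y) = cnj c * cinner x y"
  for x :: "'a::complex_inner"
  by (metis cinner_commute cinner_scaleC_left complex_cnj_mult)

lemma cinner_zero_left [simp]: "cinner 0 x = 0" for x :: "'a::complex_inner"
  using cinner_add_left[of 0 0 x] by simp

lemma cinner_zero_right [simp]: "cinner x 0 = 0" for x :: "'a::complex_inner"
  using cinner_add_right[of x 0 0] by simp

lemma cinner_diff_left: "cinner (x - y) z = cinner x z - cinner y z" for x :: "'a::complex_inner"
  using cinner_add_left[of "x - y" y z] by simp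

lemma cinner_sum_left: "cinner (\<Sum>i\<in>I. f i) z = (\<Sum>i\<in>I. cinner (f i) z)"
  for z :: "'a::complex_inner"
  by (induction I rule: infinite_finite_induct) (auto simp: cinner_add_left)

lemma cinner_self_eq_0_iff: "cinner x x = 0 \<longleftrightarrow> x = 0" for x :: "'a::complex_inner"
  by (metis Re_cinner cinner_zero_left inner_eq_zero_iff zero_complex.sel(1))

lemma csubspace_scaleR: "csubspace M \<Longrightarrow> x \<in> M \<Longrightarrow> r *\<^sub>R x \<in> M" for x :: "'a::complex_inner"
  by (metis complex_vector.subspace_scale scaleC_of_real)

lemma csubspace_left_orthogonal: "csubspace {z. cinner x z = 0}" for x :: "'a::complex_inner"
  by (auto simp: complex_vector.subspace_def cinner_add_right cinner_scaleC_right)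

section \<open>Orthogonal projections\<close>

text \<open>\<open>p - q\<close> lies in \<open>M\<close> and is a difference of two residuals
  orthogonal to \<open>M\<close>, hence is orthogonal to itself.\<close>

lemma orthogonal_residual_unique:
  fixes x :: "'a::complex_inner"
  assumes "csubspace M" "p \<in> M" "q \<in> M"
    and "\<forall>z\<in>M. cinner (x - p) z = 0" "\<forall>z\<in>M. cinner (x - q) z = 0"
  shows "p = q"
proof -
  have "p - q \<in> M"
    using assms complex_vector.subspace_diff by blast
  then have "cinner ((x - q) - (x - p)) (p - q) = 0"
    using assms(4,5) by (simp only: cinner_diff_left[of "x - q"]) simp
  then show ?thesis
    by (simp add: cinner_self_eq_0_iff)
qed

text \<open>Stands in for closedness: it records directly the decomposition property from which
  projections are built. For spans of finite orthonormal families it comes from explicit Fourier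
  sums.\<close>

definition orth_complemented :: "'a::complex_hilbert set \<Rightarrow> bool"
  where "orth_complemented M \<longleftrightarrow>
    csubspace M \<and> (\<forall>x. \<exists>p\<in>M. \<forall>z\<in>M. cinner (x - p) z = 0)"

lemma norm_le_of_orthogonal_residual:
  fixes x :: "'a::complex_inner"
  assumes "cinner (x - p) p = 0"
  shows "norm p \<le> norm x"
proof -
  have "inner (x - p) p = 0"
    by (metis Re_cinner assms zero_complex.sel(1))
  then have "norm p ^ 2 = inner x p"
    by (simp add: inner_diff_left power2_norm_eq_inner)
  also have "\<dots> \<le> norm x * norm p"
    by (rule norm_cauchy_schwarz)
  finally show ?thesis
    by (cases "p = 0") (auto simp: power2_eq_square)
qed

text \<open>Choice yields a map \<open>f\<close> picking the foot of each perpendicular. Uniqueness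
  of the foot makes \<open>f\<close> real-linear, and orthogonality of the residual makes it a
  contraction. The same uniqueness justifies the \<open>THE\<close> in
  \<open>orth_proj\<close>.\<close>

lemma is_orth_proj_orth_proj:
  assumes "orth_complemented M"
  shows "is_orth_proj M (orth_proj M)"
proof -
  have sub: "csubspace M"
    using assms by (simp add: orth_complemented_def)
  obtain f where f: "\<And>x. f x \<in> M" "\<And>x z. z \<in> M \<Longrightarrow> cinner (x - f x) z = 0"
    using assms unfolding orth_complemented_def by metis
  have unique: "f x = p" if "p \<in> M" "\<forall>z\<in>M. cinner (x - p) z = 0" for x p
    using orthogonal_residual_unique[OF sub] f that by blast
  have add: "f (x + y) = f x + f y" for x y
  proof (rule unique)
    show "f x + f y \<in> M"
      using sub f complex_vector.subspace_add by blast
    show "\<forall>z\<in>M. cinner (x + y - (f x + f y)) z = 0"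
      using f by (simp add: add_diff_add cinner_add_left)
  qed
  have scale: "f (r *\<^sub>R x) = r *\<^sub>R f x" for r x
  proof (rule unique)
    show "r *\<^sub>R f x \<in> M"
      using sub f csubspace_scaleR by blast
    have "r *\<^sub>R x - r *\<^sub>R f x = complex_of_real r *\<^sub>C (x - f x)"
      by (simp add: scaleC_of_real algebra_simps)
    then show "\<forall>z\<in>M. cinner (r *\<^sub>R x - r *\<^sub>R f x) z = 0"
      using f by (simp add: cinner_scaleC_left)
  qed
  have "norm (f x) \<le> norm x" for x
    by (rule norm_le_of_orthogonal_residual) (use f in blast)
  then have "bounded_linear f"
    by (intro bounded_linear_intro[where K = 1]) (auto simp: add scale)
  then have "is_orth_proj M (Blinfun f)"
    using f by (simp add: is_orth_proj_def bounded_linear_Blinfun_apply)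
  moreover have "P = Q" if "is_orth_proj M P" "is_orth_proj M Q" for P Q
    using that unfolding is_orth_proj_def
    by (intro blinfun_eqI) (blast intro: orthogonal_residual_unique[OF sub])
  ultimately show ?thesis
    unfolding orth_proj_def by (metis theI)
qed

context
  fixes M :: "'a::complex_hilbert set"
  assumes M: "orth_complemented M"
begin

lemma orth_proj_in: "orth_proj M x \<in> M"
  using is_orth_proj_orth_proj[OF M] by (simp add: is_orth_proj_def)

lemma orth_proj_residual: "z \<in> M \<Longrightarrow> cinner (x - orth_proj M x) z = 0"
  using is_orth_proj_orth_proj[OF M] by (simp add: is_orth_proj_def)

lemma orth_proj_apply_eqI:
  assumes "p \<in> M" "\<And>z. z \<in> M \<Longrightarrow> cinner (x - p) z = 0"
  shows "orth_proj M x = p"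
  using M orthogonal_residual_unique[of M "orth_proj M x" p x] assms orth_proj_in
    orth_proj_residual
  unfolding orth_complemented_def by blast

lemma orth_proj_apply_fixed: "x \<in> M \<Longrightarrow> orth_proj M x = x"
  by (rule orth_proj_apply_eqI) auto

lemma norm_orth_proj_le: "norm (orth_proj M) \<le> 1"
proof (rule norm_blinfun_bound)
  show "norm (orth_proj M x) \<le> 1 * norm x" for x
    using norm_le_of_orthogonal_residual[OF orth_proj_residual[OF orth_proj_in]] by simp
qed simp

text \<open>The operator type supplies only real linearity; complex homogeneity comes from the
  residual characterization of the projection.\<close>

lemma orth_proj_bounded_ops: "orth_proj M \<in> bounded_ops"
  unfolding bounded_ops_def
proof (clarify, rule orth_proj_apply_eqI)
  show "c *\<^sub>C orth_proj M x \<in> M" for c x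
    using M orth_proj_in complex_vector.subspace_scale unfolding orth_complemented_def by blast
  show "cinner (c *\<^sub>C x - c *\<^sub>C orth_proj M x) z = 0" if "z \<in> M" for c x z
    using orth_proj_residual[OF that, of x]
    by (simp add: cinner_diff_left cinner_scaleC_left)
qed

end

lemma orth_complemented_span_orthonormal:
  fixes e :: "'i \<Rightarrow> 'a::complex_hilbert"
  assumes "finite I"
    and on: "\<And>i j. i \<in> I \<Longrightarrow> j \<in> I \<Longrightarrow> cinner (e i) (e j) = (if i = j then 1 else 0)"
  shows "orth_complemented (cspan (e ` I))"
  unfolding orth_complemented_def
proof (intro conjI allI)
  show "csubspace (cspan (e ` I))"
    by simp
  fix x
  \<comment> \<open>The Fourier sum of \<open>x\<close>. Its residual annihilates every
    \<open>e j\<close>, and since the annihilated vectors form a subspace, the whole span.\<close>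
  define p where "p = (\<Sum>i\<in>I. cinner x (e i) *\<^sub>C e i)"
  have "p \<in> cspan (e ` I)"
    unfolding p_def
    by (intro complex_vector.span_sum complex_vector.span_scale complex_vector.span_base) auto
  moreover have "cinner (x - p) (e j) = 0" if "j \<in> I" for j
  proof -
    have "cinner p (e j) = (\<Sum>i\<in>I. if i = j then cinner x (e i) else 0)"
      unfolding p_def cinner_sum_left
      by (rule sum.cong) (auto simp: cinner_scaleC_left on that)
    also have "\<dots> = cinner x (e j)"
      using that assms(1) by simp
    finally show ?thesis
      by (simp add: cinner_diff_left)
  qed
  then have "cspan (e ` I) \<subseteq> {z. cinner (x - p) z = 0}"
    by (intro complex_vector.span_minimal csubspace_left_orthogonal) auto
  ultimately show "\<exists>p\<in>cspan (e ` I). \<forall>z\<in>cspan (e ` I). cinner (x - p) z = 0"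
    by blast
qed

section \<open>Orthogonal direct sums and their projections\<close>

lemma orthogonal_direct_sum_commute:
  assumes "orthogonal_direct_sum L E R"
  shows "orthogonal_direct_sum L R E"
proof -
  have "cinner y x = 0" if "x \<in> E" "y \<in> R" for x y
    using assms that cinner_commute[of y x] by (simp add: orthogonal_direct_sum_def)
  moreover have "{x + y |x y. x \<in> E \<and> y \<in> R} = {x + y |x y. x \<in> R \<and> y \<in> E}"
    using add.commute by blast
  ultimately show ?thesis
    using assms by (auto simp: orthogonal_direct_sum_def)
qed

lemma orthogonal_direct_sum_subset:
  assumes "orthogonal_direct_sum L E R"
  shows "E \<subseteq> L"
proof
  fix x assume "x \<in> E"
  moreover have "0 \<in> R"
    using assms by (simp add: orthogonal_direct_sum_def complex_vector.subspace_0)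
  ultimately show "x \<in> L"
    using assms unfolding orthogonal_direct_sum_def by (smt (verit) add.right_neutral mem_Collect_eq)
qed

text \<open>No completeness is needed: the projection onto \<open>E\<close> is the \<open>E\<close>-component of the
  projection onto \<open>L\<close>.\<close>

lemma orth_complemented_summand:
  assumes L: "orth_complemented L" and LER: "orthogonal_direct_sum L E R"
  shows "orth_complemented E"
  unfolding orth_complemented_def
proof (intro conjI allI)
  show "csubspace E"
    using LER by (simp add: orthogonal_direct_sum_def)
  fix x
  obtain y r where yr: "y \<in> E" "r \<in> R" "orth_proj L x = y + r"
    using LER orth_proj_in[OF L, of x] unfolding orthogonal_direct_sum_def by blast
  have "cinner (x - y) z = 0" if "z \<in> E" for z
  proof -
    have "cinner (x - orth_proj L x) z = 0"
      using that orthogonal_direct_sum_subset[OF LER] orth_proj_residual[OF L] by blast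
    moreover have "cinner r z = 0"
      using orthogonal_direct_sum_commute[OF LER] that yr by (simp add: orthogonal_direct_sum_def)
    ultimately show ?thesis
      by (simp add: yr cinner_diff_left cinner_add_left)
  qed
  with yr show "\<exists>p\<in>E. \<forall>z\<in>E. cinner (x - p) z = 0"
    by blast
qed

text \<open>The sum of the two components has the residual property for \<open>L\<close>: tested
  against \<open>z = u + v\<close>, the mixed terms vanish because \<open>E\<close> and
  \<open>R\<close> are orthogonal.\<close>

lemma orth_proj_orthogonal_direct_sum:
  assumes L: "orth_complemented L" and LER: "orthogonal_direct_sum L E R"
  shows "orth_proj E + orth_proj R = orth_proj L"
proof (rule blinfun_eqI)
  fix x
  note LRE = orthogonal_direct_sum_commute[OF LER]
  note E = orth_complemented_summand[OF L LER]
  note R = orth_complemented_summand[OF L LRE]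
  let ?y = "orth_proj E x" and ?r = "orth_proj R x"
  have "orth_proj L x = ?y + ?r"
  proof (rule orth_proj_apply_eqI[OF L])
    show "?y + ?r \<in> L"
      using LER orth_proj_in[OF E, of x] orth_proj_in[OF R, of x]
      unfolding orthogonal_direct_sum_def by blast
    fix z assume "z \<in> L"
    then obtain u v where uv: "u \<in> E" "v \<in> R" "z = u + v"
      using LER unfolding orthogonal_direct_sum_def by blast
    have "cinner ?r u = 0" "cinner ?y v = 0"
      using LER LRE uv orth_proj_in[OF E, of x] orth_proj_in[OF R, of x]
      by (simp_all add: orthogonal_direct_sum_def)
    moreover have "cinner (x - ?y) u = 0" "cinner (x - ?r) v = 0"
      using orth_proj_residual[OF E] orth_proj_residual[OF R] uv by auto
    ultimately show "cinner (x - (?y + ?r)) z = 0"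
      by (simp add: uv cinner_add_right cinner_diff_left cinner_add_left)
  qed
  then show "(orth_proj E + orth_proj R) x = orth_proj L x"
    by (simp add: blinfun.add_left)
qed

lemma orth_proj_compose_subset:
  assumes "orth_complemented L" "orth_complemented E" "E \<subseteq> L"
  shows "orth_proj L o\<^sub>L orth_proj E = orth_proj E"
  using assms by (intro blinfun_eqI) (auto intro!: orth_proj_apply_fixed orth_proj_in)

section \<open>Compact operators\<close>

lemma bounded_ops_compose: "F \<in> bounded_ops \<Longrightarrow> G \<in> bounded_ops \<Longrightarrow> F o\<^sub>L G \<in> bounded_ops"
  by (simp add: bounded_ops_def)

lemma bounded_ops_op_pow: "F \<in> bounded_ops \<Longrightarrow> op_pow F n \<in> bounded_ops"
  by (induction n) (auto simp: bounded_ops_compose, simp add: bounded_ops_def)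

lemma compact_ops_bounded: "F \<in> compact_ops \<Longrightarrow> F \<in> bounded_ops"
  by (simp add: compact_ops_def)

text \<open>Containment in some compact set passes through sums and continuous images more easily
  than compactness of a closure.\<close>

lemma compact_opsI:
  assumes "F \<in> bounded_ops"
    and "\<And>B. bounded B \<Longrightarrow> \<exists>K. compact K \<and> blinfun_apply F ` B \<subseteq> K"
  shows "F \<in> compact_ops"
proof -
  have "compact (closure (blinfun_apply F ` B))" if B: "bounded B" for B
  proof -
    obtain K where K: "compact K" "blinfun_apply F ` B \<subseteq> K"
      using assms(2)[OF B] by blast
    then have "closure (blinfun_apply F ` B) \<subseteq> K"
      by (simp add: closure_minimal compact_imp_closed)
    then show ?thesis
      using compact_Int_closed[OF K(1) closed_closure, of "blinfun_apply F ` B"]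
      by (simp add: inf.absorb2)
  qed
  with assms(1) show ?thesis
    by (simp add: compact_ops_def)
qed

lemma compact_opsD:
  assumes "F \<in> compact_ops" "bounded B"
  obtains K where "compact K" "blinfun_apply F ` B \<subseteq> K"
proof
  show "compact (closure (blinfun_apply F ` B))"
    using assms by (simp add: compact_ops_def)
  show "blinfun_apply F ` B \<subseteq> closure (blinfun_apply F ` B)"
    by (rule closure_subset)
qed

lemma compact_ops_add:
  assumes F: "F \<in> compact_ops" and G: "G \<in> compact_ops"
  shows "F + G \<in> compact_ops"
proof (rule compact_opsI)
  show "F + G \<in> bounded_ops"
    using assms[THEN compact_ops_bounded]
    by (simp add: bounded_ops_def blinfun.add_left scaleC_add_right)
  fix B :: "'a set" assume B: "bounded B"
  obtain K K' where K: "compact K" "blinfun_apply F ` B \<subseteq> K" "compact K'" "blinfun_apply G ` B \<subseteq> K'"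
    using compact_opsD[OF F B] compact_opsD[OF G B] by metis
  then have "compact {x + y |x y. x \<in> K \<and> y \<in> K'}"
    by (intro compact_sums)
  moreover have "blinfun_apply (F + G) ` B \<subseteq> {x + y |x y. x \<in> K \<and> y \<in> K'}"
    using K by (fastforce simp: blinfun.add_left)
  ultimately show "\<exists>K. compact K \<and> blinfun_apply (F + G) ` B \<subseteq> K"
    by blast
qed

text \<open>Two-sided ideal property: \<open>C\<close> preserves bounded sets and \<open>A\<close>
  preserves compact ones.\<close>

lemma compact_ops_compose:
  assumes F: "F \<in> compact_ops" and A: "A \<in> bounded_ops" and C: "C \<in> bounded_ops"
  shows "A o\<^sub>L F o\<^sub>L C \<in> compact_ops"
proof (rule compact_opsI)
  show "A o\<^sub>L F o\<^sub>L C \<in> bounded_ops"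
    using assms compact_ops_bounded bounded_ops_compose by blast
  fix B :: "'a set" assume "bounded B"
  then have "bounded (blinfun_apply C ` B)"
    by (simp add: bounded_linear_image blinfun.bounded_linear_right)
  with F obtain K where K: "compact K" "blinfun_apply F ` blinfun_apply C ` B \<subseteq> K"
    by (rule compact_opsD)
  then have "compact (blinfun_apply A ` K)"
    by (intro compact_continuous_image continuous_intros)
  moreover have "blinfun_apply (A o\<^sub>L F o\<^sub>L C) ` B \<subseteq> blinfun_apply A ` K"
    using K by auto
  ultimately show "\<exists>K. compact K \<and> blinfun_apply (A o\<^sub>L F o\<^sub>L C) ` B \<subseteq> K"
    by blast
qed

lemma bounded_ops_id: "id_blinfun \<in> bounded_ops"
  by (simp add: bounded_ops_def)

lemma compact_ops_compose_left:
  "F \<in> compact_ops \<Longrightarrow> A \<in> bounded_ops \<Longrightarrow> A o\<^sub>L F \<in> compact_ops"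
  using compact_ops_compose[OF _ _ bounded_ops_id] by (metis blinfun_compose_id_right)

lemma compact_ops_scaleR:
  assumes "F \<in> compact_ops"
  shows "r *\<^sub>R F \<in> compact_ops"
proof -
  \<comment> \<open>Scaling is composition with a scalar operator, so the ideal property
    applies.\<close>
  have "r *\<^sub>R id_blinfun \<in> bounded_ops"
    by (simp add: bounded_ops_def blinfun.scaleR_left scaleC_scaleC mult.commute flip: scaleC_of_real)
  moreover have "(r *\<^sub>R id_blinfun) o\<^sub>L F = r *\<^sub>R F"
    by (rule blinfun_eqI) (simp add: blinfun.scaleR_left)
  ultimately show ?thesis
    using compact_ops_compose_left[OF assms] by metis
qed

text \<open>Uniformly bounded operators converging pointwise converge uniformly on compact sets.\<close>

lemma compact_ops_approx:
  fixes P :: "nat \<Rightarrow> ('a::complex_hilbert \<Rightarrow>\<^sub>L 'a)"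
  assumes F: "F \<in> compact_ops" and P1: "\<And>m. norm (P m) \<le> 1"
    and lim: "\<And>x. (\<lambda>m. P m x) \<longlonglongrightarrow> x"
  shows "(\<lambda>m. P m o\<^sub>L F) \<longlonglongrightarrow> F"
proof (rule LIMSEQ_I)
  fix r :: real assume "0 < r"
  \<comment> \<open>The error splits into three terms, each at most \<open>d\<close>, and
    \<open>3 * d < r\<close>.\<close>
  define d where "d = r / 4"
  with \<open>0 < r\<close> have d: "d > 0"
    by simp
  obtain K where K: "compact K" "blinfun_apply F ` cball 0 1 \<subseteq> K"
    using compact_opsD[OF F bounded_cball] by metis
  \<comment> \<open>A finite \<open>d\<close>-net of \<open>K\<close> reduces uniform convergence on
    \<open>K\<close> to pointwise convergence at finitely many points.\<close>
  obtain T where T: "finite T" "K \<subseteq> (\<Union>y\<in>T. ball y d)"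
    using K(1) d unfolding compact_eq_totally_bounded by metis
  have "\<forall>\<^sub>F m in sequentially. \<forall>y\<in>T. norm (P m y - y) < d"
    using T(1) d lim by (auto simp: eventually_ball_finite_distrib tendsto_iff dist_norm)
  then obtain N where N: "\<And>m y. m \<ge> N \<Longrightarrow> y \<in> T \<Longrightarrow> norm (P m y - y) < d"
    unfolding eventually_sequentially by blast
  have "norm ((P m o\<^sub>L F) - F) < r" if "m \<ge> N" for m
  proof -
    have unit: "norm (((P m o\<^sub>L F) - F) x) \<le> 3 * d" if x: "norm x \<le> 1" for x
    proof -
      have "F x \<in> K"
        using K(2) x by auto
      then obtain y where y: "y \<in> T" "norm (F x - y) < d"
        using T(2) by (auto simp: dist_norm norm_minus_commute)
      have "norm (P m (F x - y)) \<le> norm (F x - y)"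
        using norm_blinfun[of "P m" "F x - y"] P1[of m]
        by (meson mult_left_le_one_le norm_ge_zero order_trans)
      moreover have eq: "((P m o\<^sub>L F) - F) x = P m (F x - y) + (P m y - y) - (F x - y)"
        by (simp add: blinfun.diff_left blinfun.diff_right)
      ultimately show ?thesis
        unfolding eq using y N[OF \<open>m \<ge> N\<close> y(1)]
          norm_triangle_ineq[of "P m (F x - y)" "P m y - y"]
          norm_triangle_ineq4[of "P m (F x - y) + (P m y - y)" "F x - y"]
        by linarith
    qed
    have "norm ((P m o\<^sub>L F) - F) \<le> 3 * d"
    proof (rule norm_blinfun_bound)
      fix x
      show "norm (((P m o\<^sub>L F) - F) x) \<le> 3 * d * norm x"
      proof (cases "x = 0")
        case False
        then show ?thesis
          using unit[of "x /\<^sub>R norm x"] by (simp add: blinfun.scaleR_right field_simps)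
      qed simp
    qed (use d in simp)
    then show ?thesis
      using \<open>0 < r\<close> by (simp add: d_def)
  qed
  then show "\<exists>N. \<forall>m\<ge>N. norm ((P m o\<^sub>L F) - F) < r"
    by blast
qed

section \<open>Projections along an orthonormal basis\<close>

text \<open>A vector of the algebraic span involves finitely many basis vectors, so it is fixed by
  all late projections. Density of the span and contractivity extend the convergence to every
  \<open>x\<close>.\<close>

lemma
  fixes e :: "nat \<Rightarrow> 'a::complex_hilbert"
  assumes basis: "orthonormal_basis_on {1..} e"
  shows orth_complemented_basis: "orth_complemented (cspan (e ` {1..m}))"
    and orth_proj_basis_tendsto: "(\<lambda>m. orth_proj (cspan (e ` {1..m})) x) \<longlonglongrightarrow> x"
proof -
  let ?L = "\<lambda>m. cspan (e ` {1..m})"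
  show comp: "orth_complemented (?L m)" for m
    using basis
    by (intro orth_complemented_span_orthonormal) (auto simp: orthonormal_basis_on_def)
  have fixed: "\<exists>M. \<forall>m\<ge>M. orth_proj (?L m) z = z" if "z \<in> cspan (e ` {1..})" for z
    using that
  proof (induction rule: complex_vector.span_induct_alt)
    case base
    then show ?case by simp
  next
    case (step c b z)
    then obtain M i where M: "\<forall>m\<ge>M. orth_proj (?L m) z = z" and i: "i \<ge> 1" "b = e i"
      by auto
    \<comment> \<open>\<open>m \<ge> M\<close> fixes \<open>z\<close>, and \<open>m \<ge> i\<close>
      puts \<open>b = e i\<close> into the span.\<close>
    have "orth_proj (?L m) (c *\<^sub>C b + z) = c *\<^sub>C b + z" if "m \<ge> max M i" for m
    proof -
      have "c *\<^sub>C b \<in> ?L m"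
        using i that by (intro complex_vector.span_scale complex_vector.span_base) auto
      then show ?thesis
        using orth_proj_apply_fixed[OF comp] M that by (simp add: blinfun.add_right)
    qed
    then show ?case by blast
  qed
  show "(\<lambda>m. orth_proj (?L m) x) \<longlonglongrightarrow> x"
  proof (rule LIMSEQ_I)
    fix r :: real assume "0 < r"
    then obtain z where z: "z \<in> cspan (e ` {1..})" "norm (x - z) < r / 2"
      using basis closure_approachable[of x "cspan (e ` {1..})"]
      unfolding orthonormal_basis_on_def dist_norm
      by (metis UNIV_I half_gt_zero norm_minus_commute)
    obtain M where M: "\<forall>m\<ge>M. orth_proj (?L m) z = z"
      using fixed z by blast
    have "norm (orth_proj (?L m) x - x) < r" if "m \<ge> M" for m
    proof -
      have "norm (orth_proj (?L m) (x - z)) \<le> norm (x - z)"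
        using norm_blinfun[of "orth_proj (?L m)" "x - z"] norm_orth_proj_le[OF comp]
        by (meson mult_left_le_one_le norm_ge_zero order_trans)
      moreover have eq: "orth_proj (?L m) x - x = orth_proj (?L m) (x - z) - (x - z)"
        using M that by (simp add: blinfun.diff_right)
      ultimately show ?thesis
        unfolding eq using z norm_triangle_ineq4[of "orth_proj (?L m) (x - z)" "x - z"] by linarith
    qed
    then show "\<exists>M. \<forall>m\<ge>M. norm (orth_proj (?L m) x - x) < r"
      by blast
  qed
qed

section \<open>Powers and inverses\<close>

text \<open>Evaluating \<open>V' W V\<close> in two ways shows that two inverses agree, so the
  \<open>THE\<close> in \<open>inverse_op\<close> is well defined.\<close>

lemma is_inverse_op_inverse_op:
  assumes "is_inverse_op W V"
  shows "inverse_op W = V"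
proof -
  have "V' = V" if "is_inverse_op W V'" for V'
  proof (rule blinfun_eqI)
    fix x
    have "V' x = V' ((W o\<^sub>L V) x)"
      using assms by (simp add: is_inverse_op_def)
    also have "\<dots> = (V' o\<^sub>L W) (V x)"
      by simp
    also have "\<dots> = V x"
      using that by (simp add: is_inverse_op_def)
    finally show "V' x = V x" .
  qed
  then show ?thesis
    using assms unfolding inverse_op_def by blast
qed

lemma is_inverse_op_commute: "W \<in> bounded_ops \<Longrightarrow> is_inverse_op W V \<Longrightarrow> is_inverse_op V W"
  by (simp add: is_inverse_op_def)

lemma op_pow_add_apply: "op_pow F (m + n) x = op_pow F m (op_pow F n x)"
  by (induction m) auto

lemma op_pow_double_apply: "op_pow F (2 * n) x = op_pow F n (op_pow F n x)"
  using op_pow_add_apply[of F n n] by (simp add: mult_2)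

lemma op_pow_commute: "op_pow F n (F x) = F (op_pow F n x)"
  by (induction n) auto

lemma op_pow_inverse_apply:
  assumes "is_inverse_op W V"
  shows "op_pow V n (op_pow W n x) = x"
proof (induction n arbitrary: x)
  case (Suc n)
  have "V (W y) = y" for y
    using assms by (metis blinfun_apply_blinfun_compose blinfun_apply_id_blinfun id_apply
        is_inverse_op_def)
  \<comment> \<open>Moving the outer \<open>W\<close> next to \<open>x\<close> calls for the
    induction hypothesis at \<open>W x\<close>, hence \<open>arbitrary: x\<close>.\<close>
  with Suc show ?case
    by (simp flip: op_pow_commute)
qed simp

lemma T_op_funpow: "(T_op U W ^^ n) F = op_pow W n o\<^sub>L F o\<^sub>L op_pow U n"
  by (induction n) (auto simp: T_op_def op_pow_commute intro!: blinfun_eqI)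

text \<open>Lets the formula for iterates of \<open>T_op\<close> serve for \<open>S_op\<close> as
  well.\<close>

lemma S_op_eq_T_op: "S_op U W = T_op (inverse_op U) (inverse_op W)"
  by (rule ext) (simp add: S_op_def T_op_def)

lemma norm_eq_of_cinner_eq:
  fixes x :: "'a::complex_inner" and y :: "'a"
  assumes "cinner x x = cinner y y"
  shows "norm x = norm y"
  by (metis assms Re_cinner norm_eq_sqrt_inner)

text \<open>The adjoint \<open>V\<close> is the inverse, and
  \<open>cinner (U x) (U x) = cinner x (V (U x)) = cinner x x\<close> makes \<open>U\<close>, and
  then \<open>V\<close>, isometric. Right factors built from them therefore never enlarge a
  norm.\<close>

lemma unitary_op_inverse:
  assumes "unitary_op U"
  shows "is_inverse_op U (inverse_op U)" "norm U \<le> 1" "norm (inverse_op U) \<le> 1"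
proof -
  obtain V where V: "is_adjoint_op U V" "U o\<^sub>L V = id_blinfun" "V o\<^sub>L U = id_blinfun"
    using assms by (auto simp: unitary_op_def)
  have inv: "is_inverse_op U V"
    using V by (simp add: is_inverse_op_def is_adjoint_op_def)
  have UV: "U (V x) = x" "V (U x) = x" for x
    using V by (metis blinfun_apply_blinfun_compose blinfun_apply_id_blinfun id_apply)+
  have "norm (U x) = norm x" for x
    using V UV by (intro norm_eq_of_cinner_eq) (simp add: is_adjoint_op_def)
  moreover from this have "norm (V x) = norm x" for x
    by (metis UV(1))
  ultimately show "is_inverse_op U (inverse_op U)" "norm U \<le> 1" "norm (inverse_op U) \<le> 1"
    using inv by (auto simp: is_inverse_op_inverse_op intro!: norm_blinfun_bound)
qed

lemma norm_op_pow_le_1: "norm F \<le> 1 \<Longrightarrow> norm (op_pow F n) \<le> 1"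
proof (induction n)
  case 0
  then show ?case
    by (auto intro: norm_blinfun_bound)
next
  case (Suc n)
  then show ?case
    by (auto intro!: order_trans[OF norm_blinfun_compose] mult_le_one)
qed

section \<open>The perturbation\<close>

text \<open>The factor 2 offsets the 1/2 in \<open>cosine_op\<close>. Each component is paired with
  the operator whose doubled iterate is to be small on it.\<close>

definition transitivity_witness ::
    "('a::complex_hilbert \<Rightarrow>\<^sub>L 'a) \<Rightarrow> ('a \<Rightarrow>\<^sub>L 'a) \<Rightarrow> ('a \<Rightarrow>\<^sub>L 'a) \<Rightarrow> ('a \<Rightarrow>\<^sub>L 'a) \<Rightarrow> ('a \<Rightarrow>\<^sub>L 'a)
      \<Rightarrow> nat \<Rightarrow> ('a \<Rightarrow>\<^sub>L 'a)"
  where "transitivity_witness U W F G\<^sub>E G\<^sub>R n =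
    F + 2 *\<^sub>R ((T_op U W ^^ n) G\<^sub>E + (S_op U W ^^ n) G\<^sub>R)"

text \<open>An exact identity: opposite iterates cancel and return both components, while equal
  iterates combine to exponent \<open>2 * n\<close>.\<close>

lemma cosine_op_transitivity_witness:
  assumes W: "is_inverse_op W (inverse_op W)" "W \<in> bounded_ops"
    and U: "is_inverse_op U (inverse_op U)" "U \<in> bounded_ops"
  shows "cosine_op U W n (transitivity_witness U W F G\<^sub>E G\<^sub>R n) =
    (1/2) *\<^sub>R ((T_op U W ^^ n) F + (S_op U W ^^ n) F) +
    ((T_op U W ^^ (2 * n)) G\<^sub>E + (S_op U W ^^ (2 * n)) G\<^sub>R) + (G\<^sub>E + G\<^sub>R)"
proof (rule blinfun_eqI)
  fix x
  \<comment> \<open>Both orders of cancellation occur, for \<open>S_op\<close> after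
    \<open>T_op\<close> and for \<open>T_op\<close> after \<open>S_op\<close>.\<close>
  note inv = W(1) U(1) is_inverse_op_commute[OF W(2) W(1)] is_inverse_op_commute[OF U(2) U(1)]
  note cancel = inv[THEN op_pow_inverse_apply]
  show "cosine_op U W n (transitivity_witness U W F G\<^sub>E G\<^sub>R n) x =
    ((1/2) *\<^sub>R ((T_op U W ^^ n) F + (S_op U W ^^ n) F) +
    ((T_op U W ^^ (2 * n)) G\<^sub>E + (S_op U W ^^ (2 * n)) G\<^sub>R) + (G\<^sub>E + G\<^sub>R)) x"
    by (simp add: cosine_op_def transitivity_witness_def S_op_eq_T_op T_op_funpow
        blinfun.add_left blinfun.add_right blinfun.scaleR_left blinfun.scaleR_right
        op_pow_double_apply cancel scaleR_add_right add_ac)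
qed

text \<open>Since \<open>P\<close> fixes \<open>F\<close> on the left, it can be inserted next to
  \<open>A\<close>; smallness of \<open>A o\<^sub>L P\<close> then controls the whole
  product.\<close>

lemma norm_compose_contraction_le:
  assumes "norm C \<le> 1" "P o\<^sub>L F = F"
  shows "norm (A o\<^sub>L F o\<^sub>L C) \<le> norm (A o\<^sub>L P) * norm F"
proof -
  have "A o\<^sub>L F o\<^sub>L C = (A o\<^sub>L P) o\<^sub>L F o\<^sub>L C"
    by (metis assms(2) blinfun_compose_assoc)
  also have "norm \<dots> \<le> norm ((A o\<^sub>L P) o\<^sub>L F) * norm C"
    by (rule norm_blinfun_compose)
  also have "\<dots> \<le> norm ((A o\<^sub>L P) o\<^sub>L F)"
    using assms(1) by (simp add: mult_left_le)
  also have "\<dots> \<le> norm (A o\<^sub>L P) * norm F"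
    by (rule norm_blinfun_compose)
  finally show ?thesis .
qed

text \<open>Compressions of a compact operator converge to it and stay in the carrier. The claim
  covers all large \<open>m\<close> so that one \<open>m\<close> can serve two open sets.\<close>

lemma openin_compact_ops_basis_approx:
  fixes e :: "nat \<Rightarrow> 'a::complex_hilbert"
  assumes basis: "orthonormal_basis_on {1..} e"
    and A: "openin (top_of_set compact_ops) A" "A \<noteq> {}"
  shows "\<exists>F. \<forall>\<^sub>F m in sequentially. orth_proj (cspan (e ` {1..m})) o\<^sub>L F \<in> A"
proof -
  obtain F where F: "F \<in> A" "F \<in> compact_ops"
    using A openin_imp_subset by blast
  obtain A' where A': "open A'" "A = compact_ops \<inter> A'"
    using A(1) by (auto simp: openin_open)
  note comp = orth_complemented_basis[OF basis]
  have "(\<lambda>m. orth_proj (cspan (e ` {1..m})) o\<^sub>L F) \<longlonglongrightarrow> F"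
    by (intro compact_ops_approx F norm_orth_proj_le comp orth_proj_basis_tendsto basis)
  then have "\<forall>\<^sub>F m in sequentially. orth_proj (cspan (e ` {1..m})) o\<^sub>L F \<in> A'"
    using A' F by (auto elim: topological_tendstoD)
  then have "\<forall>\<^sub>F m in sequentially. orth_proj (cspan (e ` {1..m})) o\<^sub>L F \<in> A"
    by eventually_elim
      (use A' compact_ops_compose_left[OF F(2) orth_proj_bounded_ops[OF comp]] in blast)
  then show ?thesis ..
qed

lemma eventually_in_openin:
  assumes "openin (top_of_set X) A" "l \<in> A" "(f \<longlongrightarrow> l) F" "\<And>k. f k \<in> X"
  shows "\<forall>\<^sub>F k in F. f k \<in> A"
proof -
  obtain A' where A': "open A'" "A = X \<inter> A'"
    using assms(1) by (auto simp: openin_open)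
  then show ?thesis
    using topological_tendstoD[OF assms(3), of A'] assms(2,4) by simp
qed

section \<open>Transitivity of the cosine sequence on the compact operators\<close>

theorem theorem4p1:
  fixes e :: "nat \<Rightarrow> 'a::complex_hilbert"
    and L :: "nat \<Rightarrow> 'a set"
    and U W :: "'a \<Rightarrow>\<^sub>L 'a"
  assumes basis: "orthonormal_basis_on {1..} e"
    and L: "\<And>m. L m = cspan (e ` {1..m})"
    and U: "U \<in> bounded_ops" "unitary_op U"
    and W: "W \<in> bounded_ops" "invertible_op W"
    and seqs: "\<forall>m\<ge>1. \<exists>(E :: nat \<Rightarrow> 'a set) (R :: nat \<Rightarrow> 'a set) (n :: nat \<Rightarrow> nat).
      strict_mono n \<and> (\<forall>k. 0 < n k) \<and>
      (\<forall>k. orthogonal_direct_sum (L m) (E k) (R k)) \<and>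
      (\<lambda>k. norm (op_pow W (n k) o\<^sub>L orth_proj (L m))) \<longlonglongrightarrow> 0 \<and>
      (\<lambda>k. norm (op_pow (inverse_op W) (n k) o\<^sub>L orth_proj (L m))) \<longlonglongrightarrow> 0 \<and>
      (\<lambda>k. norm (op_pow W (2 * n k) o\<^sub>L orth_proj (E k))) \<longlonglongrightarrow> 0 \<and>
      (\<lambda>k. norm (op_pow (inverse_op W) (2 * n k) o\<^sub>L orth_proj (R k))) \<longlonglongrightarrow> 0"
  shows "topologically_transitive_on compact_ops (cosine_op U W)"
  unfolding topologically_transitive_on_def
proof (intro allI impI, elim conjE)
  fix A B :: "('a \<Rightarrow>\<^sub>L 'a) set"
  assume A: "openin (top_of_set compact_ops) A" "A \<noteq> {}"
    and B: "openin (top_of_set compact_ops) B" "B \<noteq> {}"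
  define V U' where "V = inverse_op W" and "U' = inverse_op U"
  have WV: "is_inverse_op W V"
    using W(2) is_inverse_op_inverse_op unfolding invertible_op_def V_def by metis
  have UU': "is_inverse_op U U'" and U1: "norm U \<le> 1" "norm U' \<le> 1"
    unfolding U'_def using unitary_op_inverse[OF U(2)] by auto
  have V: "V \<in> bounded_ops" and U': "U' \<in> bounded_ops"
    using WV UU' by (auto simp: is_inverse_op_def)
  note comp = orth_complemented_basis[OF basis, folded L]

  obtain F' where F': "\<forall>\<^sub>F m in sequentially. orth_proj (L m) o\<^sub>L F' \<in> A"
    using openin_compact_ops_basis_approx[OF basis A] unfolding L by blast
  obtain G' where G': "\<forall>\<^sub>F m in sequentially. orth_proj (L m) o\<^sub>L G' \<in> B"
    using openin_compact_ops_basis_approx[OF basis B] unfolding L by blast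
  \<comment> \<open>One index for both targets; it must be positive for \<open>seqs\<close> to
    apply.\<close>
  obtain m where m: "m \<ge> 1" "orth_proj (L m) o\<^sub>L F' \<in> A" "orth_proj (L m) o\<^sub>L G' \<in> B"
    using eventually_happens'[OF _ eventually_conj[OF eventually_ge_at_top[of 1]
          eventually_conj[OF F' G']]] by auto
  define P F G where "P = orth_proj (L m)" and "F = P o\<^sub>L F'" and "G = P o\<^sub>L G'"
  have PP: "P o\<^sub>L P = P"
    unfolding P_def by (intro orth_proj_compose_subset comp order_refl)
  have F: "P o\<^sub>L F = F" and G: "P o\<^sub>L G = G"
    unfolding F_def G_def by (simp_all add: PP flip: blinfun_compose_assoc)
  have FA: "F \<in> A" "F \<in> compact_ops" and GB: "G \<in> B" "G \<in> compact_ops"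
    using m openin_imp_subset[OF A(1)] openin_imp_subset[OF B(1)]
    by (auto simp: F_def G_def P_def)

  obtain E R n where n: "\<And>k. 0 < n k"
    and ER: "\<And>k. orthogonal_direct_sum (L m) (E k) (R k)"
    and W0: "(\<lambda>k. norm (op_pow W (n k) o\<^sub>L P)) \<longlonglongrightarrow> 0"
    and V0: "(\<lambda>k. norm (op_pow V (n k) o\<^sub>L P)) \<longlonglongrightarrow> 0"
    and WE0: "(\<lambda>k. norm (op_pow W (2 * n k) o\<^sub>L orth_proj (E k))) \<longlonglongrightarrow> 0"
    and VR0: "(\<lambda>k. norm (op_pow V (2 * n k) o\<^sub>L orth_proj (R k))) \<longlonglongrightarrow> 0"
    using seqs[rule_format, OF m(1)] unfolding P_def V_def by blast
  note RE = orthogonal_direct_sum_commute[OF ER]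
  note E = orth_complemented_summand[OF comp ER]
  note R = orth_complemented_summand[OF comp RE]
  define GE GR where "GE k = orth_proj (E k) o\<^sub>L G" and "GR k = orth_proj (R k) o\<^sub>L G" for k
  \<comment> \<open>Compressions of \<open>G\<close> to a summand are fixed by their own projection,
    for the estimates with exponent \<open>2 * n k\<close>, and by \<open>P\<close>, for those with
    \<open>n k\<close>. The bound \<open>norm G\<close> is uniform in \<open>k\<close> although the
    summands vary.\<close>
  have component: "orth_proj M o\<^sub>L G \<in> compact_ops \<and>
      orth_proj M o\<^sub>L (orth_proj M o\<^sub>L G) = orth_proj M o\<^sub>L G \<and>
      P o\<^sub>L (orth_proj M o\<^sub>L G) = orth_proj M o\<^sub>L G \<and> norm (orth_proj M o\<^sub>L G) \<le> norm G"
    if M: "orth_complemented M" "M \<subseteq> L m" for M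
  proof (intro conjI)
    show "orth_proj M o\<^sub>L G \<in> compact_ops"
      by (intro compact_ops_compose_left GB orth_proj_bounded_ops M)
    show "orth_proj M o\<^sub>L (orth_proj M o\<^sub>L G) = orth_proj M o\<^sub>L G"
      by (simp add: orth_proj_compose_subset M flip: blinfun_compose_assoc)
    show "P o\<^sub>L (orth_proj M o\<^sub>L G) = orth_proj M o\<^sub>L G"
      by (simp add: P_def orth_proj_compose_subset comp M flip: blinfun_compose_assoc)
    show "norm (orth_proj M o\<^sub>L G) \<le> norm G"
      using norm_blinfun_compose[of "orth_proj M" G] norm_orth_proj_le[OF M(1)]
      by (meson mult_left_le_one_le norm_ge_zero order_trans)
  qed
  have GE: "GE k \<in> compact_ops" "orth_proj (E k) o\<^sub>L GE k = GE k" "P o\<^sub>L GE k = GE k"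
      "norm (GE k) \<le> norm G" for k
    using component[OF E orthogonal_direct_sum_subset[OF ER]] by (auto simp: GE_def)
  have GR: "GR k \<in> compact_ops" "orth_proj (R k) o\<^sub>L GR k = GR k" "P o\<^sub>L GR k = GR k"
      "norm (GR k) \<le> norm G" for k
    using component[OF R orthogonal_direct_sum_subset[OF RE]] by (auto simp: GR_def)
  have GEGR: "GE k + GR k = G" for k
    unfolding GE_def GR_def using orth_proj_orthogonal_direct_sum[OF comp ER] G
    by (simp add: P_def flip: blinfun_compose_add_left)

  \<comment> \<open>The common form of all six null sequences below: \<open>D k\<close> is the
    projection to insert (\<open>P\<close>, or that of \<open>E k\<close> or \<open>R k\<close>),
    and \<open>c\<close> bounds the middle factors uniformly.\<close>
  have small: "(\<lambda>k. op_pow Q (j k) o\<^sub>L H k o\<^sub>L op_pow C (j k)) \<longlonglongrightarrow> 0"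
    if "(\<lambda>k. norm (op_pow Q (j k) o\<^sub>L D k)) \<longlonglongrightarrow> 0" "norm C \<le> 1"
      "\<And>k. D k o\<^sub>L H k = H k" "\<And>k. norm (H k) \<le> c"
    for Q C :: "'a \<Rightarrow>\<^sub>L 'a" and H D :: "nat \<Rightarrow> 'a \<Rightarrow>\<^sub>L 'a" and j :: "nat \<Rightarrow> nat" and c
  proof (rule Lim_null_comparison)
    show "(\<lambda>k. norm (op_pow Q (j k) o\<^sub>L D k) * c) \<longlonglongrightarrow> 0"
      using that(1) by (rule tendsto_mult_left_zero)
    have "norm (op_pow Q (j k) o\<^sub>L H k o\<^sub>L op_pow C (j k)) \<le> norm (op_pow Q (j k) o\<^sub>L D k) * c" for k
      using norm_compose_contraction_le[OF norm_op_pow_le_1[OF that(2)] that(3)]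
        mult_left_mono[OF that(4) norm_ge_zero] by (rule order_trans)
    then show "\<forall>\<^sub>F k in sequentially.
        norm (op_pow Q (j k) o\<^sub>L H k o\<^sub>L op_pow C (j k)) \<le> norm (op_pow Q (j k) o\<^sub>L D k) * c"
      by simp
  qed
  define \<Phi> where "\<Phi> k = transitivity_witness U W F (GE k) (GR k) (n k)" for k
  have \<Phi>_eq: "\<Phi> k = F + 2 *\<^sub>R ((op_pow W (n k) o\<^sub>L GE k o\<^sub>L op_pow U (n k)) +
      (op_pow V (n k) o\<^sub>L GR k o\<^sub>L op_pow U' (n k)))" for k
    unfolding \<Phi>_def transitivity_witness_def S_op_eq_T_op T_op_funpow V_def U'_def ..
  have C\<Phi>_eq: "cosine_op U W (n k) (\<Phi> k) =
      (1/2) *\<^sub>R ((op_pow W (n k) o\<^sub>L F o\<^sub>L op_pow U (n k)) + (op_pow V (n k) o\<^sub>L F o\<^sub>L op_pow U' (n k))) +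
      ((op_pow W (2 * n k) o\<^sub>L GE k o\<^sub>L op_pow U (2 * n k)) +
       (op_pow V (2 * n k) o\<^sub>L GR k o\<^sub>L op_pow U' (2 * n k))) + G" for k
    using cosine_op_transitivity_witness[OF WV[unfolded V_def] W(1) UU'[unfolded U'_def] U(1)]
    unfolding \<Phi>_def S_op_eq_T_op T_op_funpow V_def U'_def GEGR[symmetric, of k] .
  note ops = bounded_ops_op_pow[OF W(1)] bounded_ops_op_pow[OF V]
    bounded_ops_op_pow[OF U(1)] bounded_ops_op_pow[OF U']
  \<comment> \<open>\<open>A\<close> and \<open>B\<close> are open only relative to
    \<open>compact_ops\<close>, so convergence puts the sequences into them only once they lie in
    the carrier.\<close>
  have \<Phi>_compact: "\<Phi> k \<in> compact_ops" for k
    unfolding \<Phi>_eq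
    by (intro compact_ops_add compact_ops_scaleR compact_ops_compose FA GE GR ops)
  have C\<Phi>_compact: "cosine_op U W (n k) (\<Phi> k) \<in> compact_ops" for k
    unfolding C\<Phi>_eq
    by (intro compact_ops_add compact_ops_scaleR compact_ops_compose FA GB GE GR ops)
  have "\<Phi> \<longlonglongrightarrow> F + 2 *\<^sub>R (0 + 0)"
    unfolding \<Phi>_eq[abs_def]
    by (intro tendsto_intros small[OF W0 U1(1) GE(3,4)] small[OF V0 U1(2) GR(3,4)])
  then have "\<forall>\<^sub>F k in sequentially. \<Phi> k \<in> A"
    using eventually_in_openin[OF A(1) FA(1) _ \<Phi>_compact] by simp
  \<comment> \<open>The terms in \<open>F\<close> vanish through \<open>P\<close>, the doubled terms
    through the projections onto \<open>E k\<close> and \<open>R k\<close>; only \<open>G\<close>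
    survives.\<close>
  moreover have "(\<lambda>k. cosine_op U W (n k) (\<Phi> k)) \<longlonglongrightarrow> (1/2) *\<^sub>R (0 + 0) + (0 + 0) + G"
    unfolding C\<Phi>_eq
    by (intro tendsto_intros small[OF W0 U1(1) F order_refl] small[OF V0 U1(2) F order_refl]
        small[OF WE0 U1(1) GE(2,4)] small[OF VR0 U1(2) GR(2,4)])
  then have "\<forall>\<^sub>F k in sequentially. cosine_op U W (n k) (\<Phi> k) \<in> B"
    using eventually_in_openin[OF B(1) GB(1) _ C\<Phi>_compact] by simp
  ultimately have "\<forall>\<^sub>F k in sequentially. \<Phi> k \<in> A \<and> cosine_op U W (n k) (\<Phi> k) \<in> B"
    by (rule eventually_conj)
  then obtain k where "\<Phi> k \<in> A" "cosine_op U W (n k) (\<Phi> k) \<in> B"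
    using eventually_happens' sequentially_bot by blast
  moreover have "n k \<ge> 1"
    using n[of k] by simp
  ultimately show "\<exists>n\<ge>1. cosine_op U W n ` A \<inter> B \<noteq> {}"
    by blast
qed

end
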